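(* If $F\in\mathbb{C}[X,Y]^2$ satisfies $\det J_F(X,Y)\in\mathbb{C}^{\times}$, then $$|\mathbb{C}^2-F(\mathbb{C}^2)|\le(\deg F)^3+(\deg F)^2-(\deg F).$$
   Context: $F=(P,Q)$ is viewed as a polynomial mapping $\mathbb{C}^2\to\mathbb{C}^2$, $J_F$ is its Jacobian matrix, $\mathbb{C}^{\times}$ is the set of nonzero constants, $\deg F=\max(\deg P,\deg Q)$ (total degrees), and $|\cdot|$ denotes cardinality. *)

theory Defs
  imports
    "HOL-Analysis.Analysis"
    "HOL-Computational_Algebra.Polynomial"
begin

text \<open>
  The ring \<open>\<complex>[X,Y]\<close> is taken to be \<open>\<complex>[X][Y]\<close>, i.e. \<^typ>\<open>complex poly poly\<close>:
  \<open>X\<close> is the inner and \<open>Y\<close> the outer variable, so the coefficient of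
  \<open>X ^ i * Y ^ j\<close> in \<open>p\<close> is \<open>coeff (coeff p j) i\<close>.
\<close>

type_synonym bipoly = "complex poly poly"

definition monomials :: "bipoly \<Rightarrow> (nat \<times> nat) set" where
  "monomials p = {(i, j). coeff (coeff p j) i \<noteq> 0}"

text \<open>Total degree. As for \<^const>\<open>degree\<close>, the zero polynomial gets degree \<open>0\<close>.\<close>

definition total_degree :: "bipoly \<Rightarrow> nat" where
  "total_degree p = Max (insert 0 ((\<lambda>(i, j). i + j) ` monomials p))"

text \<open>The inner \<^const>\<open>poly\<close> substitutes the constant polynomial \<open>y\<close> for \<open>Y\<close>.\<close>

definition eval2 :: "bipoly \<Rightarrow> complex \<Rightarrow> complex \<Rightarrow> complex" where
  "eval2 p x y = poly (poly p [:y:]) x"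

definition partial_X :: "bipoly \<Rightarrow> bipoly" where
  "partial_X p = map_poly pderiv p"

definition partial_Y :: "bipoly \<Rightarrow> bipoly" where
  "partial_Y p = pderiv p"

definition poly_mapping2 :: "bipoly \<times> bipoly \<Rightarrow> complex \<times> complex \<Rightarrow> complex \<times> complex" where
  "poly_mapping2 F = (\<lambda>(x, y). (eval2 (fst F) x y, eval2 (snd F) x y))"

definition degree2 :: "bipoly \<times> bipoly \<Rightarrow> nat" where
  "degree2 F = max (total_degree (fst F)) (total_degree (snd F))"

definition jacobian2 :: "bipoly \<times> bipoly \<Rightarrow> bipoly ^ 2 ^ 2" where
  "jacobian2 F = vector [vector [partial_X (fst F), partial_Y (fst F)],
                         vector [partial_X (snd F), partial_Y (snd F)]]"

lemma finite_monomials: "finite (monomials p)"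
proof -
  have "monomials p \<subseteq> (\<Union>j\<in>{..degree p}. {..degree (coeff p j)} \<times> {j})"
    by (auto simp: monomials_def intro!: le_degree)
  then show ?thesis
    by (rule finite_subset) auto
qed

lemma eval2_altdef:
  "eval2 p x y = (\<Sum>j\<le>degree p. \<Sum>i\<le>degree (coeff p j). coeff (coeff p j) i * x ^ i * y ^ j)"
  by (simp add: eval2_def poly_altdef[of p] poly_sum poly_altdef[of "coeff p _"] sum_distrib_right
      poly_power)

lemma coeff_partial_X:
  "coeff (coeff (partial_X p) j) i = of_nat (Suc i) * coeff (coeff p j) (Suc i)"
  by (simp add: partial_X_def coeff_map_poly coeff_pderiv)

lemma coeff_partial_Y:
  "coeff (coeff (partial_Y p) j) i = of_nat (Suc j) * coeff (coeff p (Suc j)) i"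
  by (simp add: partial_Y_def coeff_pderiv of_nat_poly del: of_nat_Suc)

lemma det_jacobian2:
  "det (jacobian2 (P, Q)) = partial_X P * partial_Y Q - partial_Y P * partial_X Q"
  by (simp add: jacobian2_def det_2)

end

theory Submission
  imports
    "Subresultants.Subresultant_Gcd"
    "HOL-Computational_Algebra.Field_as_Ring"
    "HOL-Computational_Algebra.Fundamental_Theorem_Algebra"
    Defs
begin

text \<open>
  Let \<open>F = (P, Q)\<close> have nonzero constant Jacobian determinant and degree \<open>d\<close>.  A point \<open>(a, b)\<close> is
  missed if it is not a value of \<open>F\<close>.  The number of missed points is in fact at most \<open>2 * d ^ 2\<close>,
  which is at most \<open>d ^ 3 + d ^ 2 - d\<close> for \<open>d \<ge> 2\<close>; for \<open>d = 1\<close> the map is an affine bijection.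

  A linear change of the source makes the leading coefficients of \<open>P\<close> and \<open>Q\<close> in \<open>Y\<close> nonzero
  constants (lemma \<open>shear_leading\<close>); let \<open>m, n \<le> d\<close> be the degrees in \<open>Y\<close>.  Let \<open>R(u, v, X)\<close> be the
  resultant of \<open>P - u\<close> and \<open>Q - v\<close> with respect to \<open>Y\<close>.  Then \<open>R(a, b, x) = 0\<close> exactly if the fibre
  over \<open>(a, b)\<close> meets the line \<open>X = x\<close>.  Moreover \<open>R(a, b, X)\<close> is never the zero polynomial, because
  a common factor of \<open>P - a\<close> and \<open>Q - b\<close> would divide the Jacobian determinant
  (\<open>jac_imp_no_common_factor\<close>).  So \<open>(a, b)\<close> is missed if and only if \<open>R(a, b, X)\<close> is constant in \<open>X\<close>,
  that is, if it is a common zero of all the differences \<open>R(u, v, x) - R(u, v, x')\<close>.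

  These differences have degree at most \<open>n\<close> in \<open>u\<close> and at most \<open>m\<close> in \<open>v\<close>.  They have no common
  divisor \<open>p\<close> of positive degree in \<open>v\<close>: all zeros of \<open>p\<close> would be missed, so \<open>p(P, Q)\<close> would have no
  zero and be constant, but \<open>P\<close> and \<open>Q\<close> are algebraically independent
  (\<open>missed_eqns_no_common_divisor\<close>, \<open>jac_imp_alg_independent\<close>).  Hence there are two equations of this
  bidegree for the missed points with nonzero resultant with respect to \<open>v\<close>.  That resultant is a
  polynomial in \<open>u\<close> of degree at most \<open>2 * m * n\<close>, and the first coordinates of all missed points are
  among its roots (\<open>card_missed_inj_fst\<close>).  A linear change of the target separates the first
  coordinates of any given finite set of missed points, so every finite set of missed points, and
  therefore the set of all of them, has at most \<open>2 * d ^ 2\<close> elements.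
\<close>

section \<open>Bivariate polynomials: evaluation, derivatives, substitution\<close>

definition slice :: "bipoly \<Rightarrow> complex \<Rightarrow> complex poly" where
  "slice p x = map_poly (\<lambda>c. poly c x) p"

abbreviation const2 :: "complex \<Rightarrow> bipoly" where
  "const2 z \<equiv> [:[:z:]:]"

definition jac :: "bipoly \<Rightarrow> bipoly \<Rightarrow> bipoly" where
  "jac P Q = partial_X P * partial_Y Q - partial_Y P * partial_X Q"

definition missed :: "bipoly \<Rightarrow> bipoly \<Rightarrow> (complex \<times> complex) set" where
  "missed P Q = {(a, b). \<nexists>x y. eval2 P x y = a \<and> eval2 Q x y = b}"

lemma eval2_simps [simp]:
  "eval2 0 x y = 0"
  "eval2 (pCons c p) x y = poly c x + y * eval2 p x y"
  "eval2 (p + q) x y = eval2 p x y + eval2 q x y"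
  "eval2 (p - q) x y = eval2 p x y - eval2 q x y"
  "eval2 (p * q) x y = eval2 p x y * eval2 q x y"
  "eval2 (smult c p) x y = poly c x * eval2 p x y"
  "eval2 1 x y = 1"
  by (simp_all add: eval2_def)

lemma poly_slice: "poly (slice p x) y = eval2 p x y"
  unfolding slice_def by (induction p) (simp_all add: Polynomial.map_poly_pCons)

lemma eval2_hom: "comm_ring_hom (\<lambda>h. eval2 h a b)"
  by (unfold_locales) (simp_all)

lemma partial_X_pCons [simp]: "partial_X (pCons c p) = pCons (pderiv c) (partial_X p)"
  by (simp add: partial_X_def Polynomial.map_poly_pCons)

lemma partial_Y_pCons [simp]: "partial_Y (pCons c p) = p + pCons 0 (partial_Y p)"
  by (simp add: partial_Y_def pderiv_pCons)

lemma partial_0 [simp]: "partial_X 0 = 0" "partial_Y 0 = 0"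
  by (simp_all add: partial_X_def partial_Y_def)

lemma partial_X_add [simp]: "partial_X (p + q) = partial_X p + partial_X q"
  by (rule poly_eqI, rule poly_eqI) (simp add: coeff_partial_X algebra_simps)

lemma partial_Y_add [simp]: "partial_Y (p + q) = partial_Y p + partial_Y q"
  by (simp add: partial_Y_def pderiv_add)

lemma partial_X_smult: "partial_X (smult c p) = smult (pderiv c) p + smult c (partial_X p)"
  by (induction p) (simp_all add: pderiv_mult algebra_simps)

lemma partial_X_mult: "partial_X (p * q) = partial_X p * q + p * partial_X q"
  by (induction p) (simp_all add: partial_X_smult algebra_simps)

lemma partial_Y_mult: "partial_Y (p * q) = partial_Y p * q + p * partial_Y q"
  by (simp add: partial_Y_def pderiv_mult algebra_simps)

text \<open>
  Substitution of bivariate polynomials into a univariate and into a bivariate one.  With \<open>comp2\<close>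
  the chain rule covers both the pullback of \<open>h\<close> along \<open>(P, Q)\<close> and linear changes of the source
  variables.
\<close>

definition comp1 :: "complex poly \<Rightarrow> bipoly \<Rightarrow> bipoly" where
  "comp1 c A = poly (map_poly const2 c) A"

definition comp2 :: "bipoly \<Rightarrow> bipoly \<Rightarrow> bipoly \<Rightarrow> bipoly" where
  "comp2 p A B = poly (map_poly (\<lambda>c. comp1 c A) p) B"

lemma comp1_0 [simp]: "comp1 0 A = 0"
  by (simp add: comp1_def)

lemma comp1_pCons [simp]: "comp1 (pCons z c) A = const2 z + A * comp1 c A"
  by (simp add: comp1_def Polynomial.map_poly_pCons)

lemma comp2_0 [simp]: "comp2 0 A B = 0"
  by (simp add: comp2_def)

lemma comp2_pCons [simp]: "comp2 (pCons c p) A B = comp1 c A + B * comp2 p A B"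
  by (simp add: comp2_def Polynomial.map_poly_pCons)

lemma comp1_add: "comp1 (c + d) A = comp1 c A + comp1 d A"
  by (induction c d rule: poly_induct2) (simp_all add: algebra_simps)

lemma comp1_smult: "comp1 (smult z c) A = const2 z * comp1 c A"
  by (induction c) (simp_all add: algebra_simps)

lemma comp1_mult: "comp1 (c * d) A = comp1 c A * comp1 d A"
  by (induction c) (simp_all add: comp1_add comp1_smult algebra_simps)

lemma comp2_add: "comp2 (p + q) A B = comp2 p A B + comp2 q A B"
  by (induction p q rule: poly_induct2) (simp_all add: comp1_add algebra_simps)

lemma comp2_smult: "comp2 (smult c p) A B = comp1 c A * comp2 p A B"
  by (induction p) (simp_all add: comp1_mult algebra_simps)

lemma comp2_mult: "comp2 (p * q) A B = comp2 p A B * comp2 q A B"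
  by (induction p) (simp_all add: comp2_add comp2_smult algebra_simps)

lemma comp2_diff: "comp2 (p - q) A B = comp2 p A B - comp2 q A B"
  using comp2_add[of "p - q" q A B] by (simp add: algebra_simps)

lemma eval2_comp1: "eval2 (comp1 c A) x y = poly c (eval2 A x y)"
  by (induction c) simp_all

lemma eval2_comp2: "eval2 (comp2 p A B) x y = eval2 p (eval2 A x y) (eval2 B x y)"
  by (induction p) (simp_all add: eval2_comp1)

lemma partial_comp1:
  "partial_X (comp1 c A) = comp1 (pderiv c) A * partial_X A"
  "partial_Y (comp1 c A) = comp1 (pderiv c) A * partial_Y A"
  by (induction c)
     (simp_all add: partial_X_mult partial_Y_mult pderiv_pCons comp1_add algebra_simps)

lemma partial_comp2:
  "partial_X (comp2 p A B) =
     comp2 (partial_X p) A B * partial_X A + comp2 (partial_Y p) A B * partial_X B"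
  "partial_Y (comp2 p A B) =
     comp2 (partial_X p) A B * partial_Y A + comp2 (partial_Y p) A B * partial_Y B"
  by (induction p)
     (simp_all add: partial_X_mult partial_Y_mult partial_comp1 comp2_add algebra_simps)

section \<open>Consequences of a constant Jacobian determinant\<close>

lemma bipoly_no_zero_imp_const:
  assumes "\<And>x y. eval2 p x y \<noteq> 0"
  shows "\<exists>z. p = const2 z"
proof -
  have deg_slice: "degree (slice p x) = 0" for x
  proof (rule ccontr)
    assume "degree (slice p x) \<noteq> 0"
    then obtain y where "poly (slice p x) y = 0"
      using alg_closed_imp_poly_has_root[of "slice p x"] by blast
    with assms show False by (simp add: poly_slice)
  qed
  have coeff_0: "coeff p j = 0" if "j > 0" for j
  proof -
    have "poly (coeff p j) x = 0" for x
      using deg_slice[of x] that coeff_eq_0[of "slice p x" j]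
      by (simp add: slice_def coeff_map_poly)
    then show ?thesis by (intro poly_all_0_iff_0[THEN iffD1] allI)
  qed
  have "degree p = 0"
  proof (rule ccontr)
    assume "degree p \<noteq> 0"
    then have "lead_coeff p = 0" by (intro coeff_0) simp
    then have "p = 0" by (simp only: leading_coeff_0_iff)
    with \<open>degree p \<noteq> 0\<close> show False by simp
  qed
  then obtain c where c: "p = [:c:]" by (rule degree_eq_zeroE)
  have "degree c = 0"
  proof (rule ccontr)
    assume "degree c \<noteq> 0"
    then obtain x where "poly c x = 0"
      using alg_closed_imp_poly_has_root[of c] by blast
    with assms[of x 0] show False by (simp add: c)
  qed
  then obtain z where "c = [:z:]" by (rule degree_eq_zeroE)
  with c show ?thesis by blast
qed

text \<open>
  By the chain rule, the two partial derivatives of a relation \<open>h\<close> between \<open>P\<close> and \<open>Q\<close> solve a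
  linear system whose determinant is the Jacobian, hence are relations again.  Differentiating a
  nonzero relation as often as its degrees allow would therefore produce a nonzero constant relation.
\<close>

lemma jac_imp_alg_independent:
  assumes jac: "jac P Q = const2 c" "c \<noteq> 0" and h: "comp2 h P Q = 0"
  shows "h = 0"
proof (rule ccontr)
  have step: "comp2 (partial_X h) P Q = 0 \<and> comp2 (partial_Y h) P Q = 0" 
    if "comp2 h P Q = 0" for h
  proof -
    let ?u = "comp2 (partial_X h) P Q" and ?v = "comp2 (partial_Y h) P Q"
    have 1: "?u * partial_X P + ?v * partial_X Q = 0" "?u * partial_Y P + ?v * partial_Y Q = 0"
      using partial_comp2[of h P Q] that by simp_all
    have "?u * jac P Q = (?u * partial_X P + ?v * partial_X Q) * partial_Y Q
        - (?u * partial_Y P + ?v * partial_Y Q) * partial_X Q"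
      by (simp add: jac_def algebra_simps)
    moreover have "?v * jac P Q = (?u * partial_Y P + ?v * partial_Y Q) * partial_X P
        - (?u * partial_X P + ?v * partial_X Q) * partial_Y P"
      by (simp add: jac_def algebra_simps)
    ultimately have "?u * jac P Q = 0" "?v * jac P Q = 0"
      unfolding 1 by simp_all
    then show ?thesis using jac by (simp del: mult_pCons_right)
  qed
  assume "h \<noteq> 0"
  with h have "\<exists>c. c \<noteq> 0 \<and> comp1 c P = 0"
  proof (induction "degree h" arbitrary: h rule: less_induct)
    case less
    show ?case
    proof (cases "degree h = 0")
      case True
      then obtain c where "h = [:c:]" by (rule degree_eq_zeroE)
      with less.prems show ?thesis by auto
    next
      case False
      then show ?thesis
        using less.hyps[of "partial_Y h"] step[OF less.prems(1)]
        by (auto simp: partial_Y_def degree_pderiv pderiv_eq_0_iff)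
    qed
  qed
  then obtain c where "c \<noteq> 0" "comp1 c P = 0" by blast
  then show False
  proof (induction "degree c" arbitrary: c rule: less_induct)
    case less
    show ?case
    proof (cases "degree c = 0")
      case True
      then obtain z where "c = [:z:]" by (rule degree_eq_zeroE)
      with less.prems show ?thesis by auto
    next
      case False
      have "comp1 (pderiv c) P = 0"
        using step[of "[:c:]"] less.prems by simp
      then show ?thesis
        using less.hyps[of "pderiv c"] False
        by (auto simp: degree_pderiv pderiv_eq_0_iff)
    qed
  qed
qed

text \<open>
  Modulo a common factor \<open>h\<close> of \<open>P - a\<close> and \<open>Q - b\<close>, both gradients are multiples of the gradient of
  \<open>h\<close>, so \<open>h\<close> divides the Jacobian determinant.
\<close>

lemma jac_imp_no_common_factor:
  assumes jac: "jac P Q = const2 c" "c \<noteq> 0"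
    and dvd: "h dvd P - const2 a" "h dvd Q - const2 b"
  shows "degree h = 0"
proof -
  obtain A B where AB: "P = const2 a + h * A" "Q = const2 b + h * B"
    using dvd by (metis dvdE add.commute diff_add_cancel)
  have "jac P Q = h * (partial_X h * A * partial_Y B + partial_X A * partial_Y h * B
      + h * partial_X A * partial_Y B - partial_Y h * A * partial_X B
      - partial_Y A * partial_X h * B - h * partial_Y A * partial_X B)"
    unfolding jac_def AB by (simp add: partial_X_mult partial_Y_mult algebra_simps)
  then have "h dvd const2 c" using jac by (metis dvdI)
  then show ?thesis using \<open>c \<noteq> 0\<close> dvd_imp_degree_le[of h "const2 c"] by simp
qed

section \<open>Resultants: degree bounds, common roots, common factors\<close>

text \<open>
  The same degree bound for resultants is needed for two different degrees on \<open>\<complex>[u][v]\<close>, the one in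
  the inner variable and the one in the outer variable.  It only rests on the axioms below, where
  \<open>D k x\<close> means that \<open>x\<close> has degree at most \<open>k\<close>.
\<close>

locale degree_filtration =
  fixes D :: "nat \<Rightarrow> 'a :: comm_ring_1 \<Rightarrow> bool"
  assumes zero: "D k 0"
    and one: "D 0 1"
    and uminus: "D k x \<Longrightarrow> D k (- x)"
    and add: "D k x \<Longrightarrow> D k y \<Longrightarrow> D k (x + y)"
    and mult: "D k x \<Longrightarrow> D l y \<Longrightarrow> D (k + l) (x * y)"
begin

lemma sum: "(\<And>i. i \<in> I \<Longrightarrow> D k (f i)) \<Longrightarrow> D k (\<Sum>i\<in>I. f i)"
  by (induction I rule: infinite_finite_induct) (auto simp: zero add)

lemma prod: "(\<And>i. i \<in> I \<Longrightarrow> D (e i) (f i)) \<Longrightarrow> D (\<Sum>i\<in>I. e i) (\<Prod>i\<in>I. f i)"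
  by (induction I rule: infinite_finite_induct) (auto simp: one mult)

text \<open>
  Each term of the determinant of the Sylvester matrix takes one entry from each of the \<open>degree q\<close>
  rows of coefficients of \<open>p\<close> and from each of the \<open>degree p\<close> rows of coefficients of \<open>q\<close>.
\<close>

lemma resultant:
  assumes p: "\<And>i. D a (coeff p i)" and q: "\<And>i. D b (coeff q i)"
  shows "D (degree q * a + degree p * b) (resultant p q)"
proof -
  let ?m = "degree p" and ?n = "degree q"
  let ?S = "sylvester_mat p q"
  define e where "e i = (if i < ?n then a else b)" for i
  have entry: "D (e i) (?S $$ (i, j))" if "i < ?m + ?n" "j < ?m + ?n" for i j
    using that p q by (auto simp: sylvester_index_mat e_def zero)
  have "(\<Sum>i\<in>{0..<?m + ?n}. e i) = (\<Sum>i\<in>{0..<?n}. e i) + (\<Sum>i\<in>{?n..<?n + ?m}. e i)"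
    by (simp add: sum.atLeastLessThan_concat add.commute)
  also have "\<dots> = ?n * a + ?m * b"
    by (simp add: e_def)
  finally have e: "(\<Sum>i\<in>{0..<?m + ?n}. e i) = ?n * a + ?m * b" .
  have "D (?n * a + ?m * b)
      (of_int (sign \<pi>) * (\<Prod>i = 0..<?m + ?n. ?S $$ (i, \<pi> i)))"
    if "\<pi> permutes {0..<?m + ?n}" for \<pi>
  proof -
    have "D (?n * a + ?m * b) (\<Prod>i = 0..<?m + ?n. ?S $$ (i, \<pi> i))"
      unfolding e[symmetric]
    proof (rule prod, rule entry)
      fix i assume i: "i \<in> {0..<?m + ?n}"
      then show "i < ?m + ?n" by simp
      show "\<pi> i < ?m + ?n" using permutes_in_image[OF that, of i] i by simp
    qed
    then show ?thesis by (cases \<pi> rule: sign_cases) (simp_all add: uminus)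
  qed
  then show ?thesis
    by (auto simp: resultant_def Determinant.det_def intro!: sum)
qed

end

lemma degree_filtration_degree:
  "degree_filtration (\<lambda>k (p :: 'a :: comm_ring_1 poly). degree p \<le> k)"
  by unfold_locales 
     (auto intro: degree_add_le order_trans[OF degree_mult_le])

lemma degree_filtration_coeff_degree:
  "degree_filtration (\<lambda>k (p :: 'a :: comm_ring_1 poly poly). \<forall>j. degree (coeff p j) \<le> k)"
proof unfold_locales
  fix k l :: nat and x y :: "'a poly poly"
  assume "\<forall>j. degree (coeff x j) \<le> k" "\<forall>j. degree (coeff y j) \<le> l"
  then show "\<forall>j. degree (coeff (x * y) j) \<le> k + l"
    by (auto simp: coeff_mult intro!: degree_sum_le order_trans[OF degree_mult_le] add_mono)
qed (auto intro: degree_add_le simp: coeff_1)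

text \<open>
  The vector of powers of the common root lies in the kernel.  The statement allows degrees smaller
  than \<open>m\<close> and \<open>n\<close> because leading coefficients may vanish when a matrix over \<open>\<complex>[X]\<close> is specialised at
  a point.
\<close>

lemma sylvester_mat_sub_common_root:
  fixes p q :: "'a :: field poly"
  assumes mn: "m + n > 0" and deg: "degree p \<le> m" "degree q \<le> n"
    and root: "poly p y = 0" "poly q y = 0"
  shows "Determinant.det (sylvester_mat_sub m n p q) = 0"
proof -
  let ?S = "sylvester_mat_sub m n p q"
  define v where "v = Matrix.vec (m + n) (\<lambda>j. y ^ (m + n - 1 - j))"
  have v: "v \<in> carrier_vec (m + n)" by (simp add: v_def)
  have v0: "v \<noteq> 0\<^sub>v (m + n)"
  proof
    assume "v = 0\<^sub>v (m + n)"
    then have "vec_index v (m + n - 1) = vec_index (0\<^sub>v (m + n)) (m + n - 1)" by simp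
    then show False using mn by (simp add: v_def)
  qed
  have eval: "(\<Sum>k\<le>d. coeff r k * y ^ k) = poly r y" if "degree r \<le> d" for r :: "'a poly" and d
    unfolding poly_altdef using that
    by (intro sum.mono_neutral_right) (auto simp: coeff_eq_0)
  have row: "Matrix.row ?S i \<bullet> v = 0" if i: "i < m + n" for i
  proof -
    have "Matrix.row ?S i \<bullet> v = (\<Sum>j<m + n. ?S $$ (i, j) * y ^ (m + n - 1 - j))"
      using i by (simp add: scalar_prod_def v_def atLeast0LessThan)
    also have "\<dots> = 0"
    proof (cases "i < n")
      case True
      have "(\<Sum>j<m + n. ?S $$ (i, j) * y ^ (m + n - 1 - j))
          = (\<Sum>j\<in>{i..i + m}. coeff p (m + i - j) * y ^ (m + n - 1 - j))"
        using True by (intro sum.mono_neutral_cong_right) (auto simp: sylvester_mat_sub_index)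
      also have "\<dots> = (\<Sum>k\<le>m. coeff p k * y ^ k * y ^ (n - 1 - i))"
        using True by (intro sum.reindex_bij_witness[of _ "\<lambda>k. m + i - k" "\<lambda>j. m + i - j"])
           (auto simp flip: power_add)
      also have "\<dots> = 0"
        using eval[OF deg(1)] root by (simp flip: sum_distrib_right)
      finally show ?thesis .
    next
      case False
      have "(\<Sum>j<m + n. ?S $$ (i, j) * y ^ (m + n - 1 - j))
          = (\<Sum>j\<in>{i - n..i}. coeff q (i - j) * y ^ (m + n - 1 - j))"
        using False i by (intro sum.mono_neutral_cong_right) (auto simp: sylvester_mat_sub_index)
      also have "\<dots> = (\<Sum>k\<le>n. coeff q k * y ^ k * y ^ (m + n - 1 - i))"
        using False i by (intro sum.reindex_bij_witness[of _ "\<lambda>k. i - k" "\<lambda>j. i - j"])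
           (auto simp flip: power_add)
      also have "\<dots> = 0"
        using eval[OF deg(2)] root by (simp flip: sum_distrib_right)
      finally show ?thesis .
    qed
    finally show ?thesis .
  qed
  have "?S *\<^sub>v v = 0\<^sub>v (m + n)"
    by (rule eq_vecI) (simp_all add: row)
  then show ?thesis
    using det_0_iff_vec_prod_zero_field[OF sylvester_mat_sub_carrier[of m n p q]] v v0 by blast
qed

lemma resultant_common_root:
  fixes p q :: bipoly
  assumes "degree p + degree q > 0"
    and "eval2 p x y = 0" "eval2 q x y = 0"
  shows "poly (resultant p q) x = 0"
proof -
  have sl: "poly (map_poly (\<lambda>c. poly c x) p) y = eval2 p x y" for p
    using poly_slice by (simp add: slice_def)
  have "poly (resultant p q) x
      = Determinant.det (map_mat (\<lambda>c. poly c x) (sylvester_mat_sub (degree p) (degree q) p q))"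
    by (simp add: resultant_sub resultant_sub_def comm_ring_hom.hom_det[OF poly_hom.comm_ring_hom_axioms])
  also have "\<dots> = 0"
    unfolding sylvester_mat_sub_map[of "\<lambda>c. poly c x", OF poly_0]
    using assms sl by (intro sylvester_mat_sub_common_root[where y = y]) (auto intro: degree_map_poly_le)
  finally show ?thesis .
qed

lemma prime_factor_pos_degree:
  fixes d :: bipoly
  assumes "degree d > 0"
  shows "\<exists>p. prime p \<and> p dvd d \<and> degree p > 0"
  using assms
proof (induction d rule: prime_divisors_induct)
  case (unit d)
  then show ?case by (metis is_unit_iff_degree degree_0 less_numeral_extra(3) poly_dvd_1)
next
  case (factor p x)
  show ?case
  proof (cases "degree p > 0")
    case False
    have "degree x > 0"
      using factor.prems False degree_mult_le[of p x] by linarith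
    then show ?thesis using factor.IH by (meson dvd_mult)
  qed (use factor in auto)
qed simp

lemma resultant_eq_0_imp_common_prime:
  fixes f g :: bipoly
  assumes "resultant f g = 0"
  shows "\<exists>p. prime p \<and> degree p > 0 \<and> p dvd f \<and> p dvd g"
  using assms prime_factor_pos_degree[of "gcd f g"] by (auto simp: resultant_0_gcd)

lemma complex_resultant_eq_0_imp_common_root:
  fixes f g :: "complex poly"
  assumes "resultant f g = 0"
  shows "\<exists>y. poly f y = 0 \<and> poly g y = 0"
proof -
  have "degree (gcd f g) > 0" using assms by (simp add: resultant_0_gcd)
  then obtain y where "poly (gcd f g) y = 0"
    using alg_closed_imp_poly_has_root by blast
  then show ?thesis by (meson dvd_trans gcd_dvd1 gcd_dvd2 poly_eq_0_iff_dvd)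
qed

text \<open>
  A vector space of polynomials is not a finite union of proper subspaces.  If \<open>g\<close> and \<open>h\<close> are not
  both divisible by \<open>q\<close>, then \<open>q\<close> divides \<open>g + z * h\<close> for at most one scalar \<open>z\<close>.
\<close>

lemma linear_family_avoids_divisors:
  fixes W :: "bipoly set"
  assumes "finite A" and W0: "0 \<in> W"
    and W: "\<And>g h z. g \<in> W \<Longrightarrow> h \<in> W \<Longrightarrow> g + const2 z * h \<in> W"
    and ex: "\<And>p. p \<in> A \<Longrightarrow> \<exists>g\<in>W. \<not> p dvd g"
  shows "\<exists>g\<in>W. \<forall>p\<in>A. \<not> p dvd g"
  using \<open>finite A\<close> ex
proof (induction A rule: finite_induct)
  case empty
  then show ?case using W0 by blast
next
  case (insert p A)
  from insert.IH insert.prems obtain g where g: "g \<in> W" "\<forall>p\<in>A. \<not> p dvd g"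
    by blast
  from insert.prems obtain h where h: "h \<in> W" "\<not> p dvd h"
    by blast
  define bad where "bad q = {z. q dvd g + const2 z * h}" for q
  have "finite (bad q)" if q: "q \<in> insert p A" for q
  proof -
    have "z = z'" if "z \<in> bad q" "z' \<in> bad q" for z z'
    proof (rule ccontr)
      assume "z \<noteq> z'"
      have "q dvd (g + const2 z * h) - (g + const2 z' * h)"
        using that unfolding bad_def by (intro dvd_diff) auto
      also have "\<dots> = [:[:z - z':]:] * h" by (simp add: smult_diff_left[symmetric])
      finally have "q dvd [:[:1 / (z - z'):]:] * ([:[:z - z':]:] * h)" by (rule dvd_mult)
      also have "\<dots> = h" using \<open>z \<noteq> z'\<close> by (simp add: one_pCons[symmetric])
      finally have "q dvd h" .
      moreover from this have "q dvd g"
        using that(1) dvd_add_left_iff[of q "const2 z * h" g] unfolding bad_def 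
        by (metis dvd_mult mem_Collect_eq)
      ultimately show False using q g h by auto
    qed
    then have "bad q \<subseteq> {SOME z. z \<in> bad q}" by (metis singletonI someI subsetI)
    then show ?thesis using finite_subset by blast
  qed
  then have "finite (\<Union>q\<in>insert p A. bad q)" using insert.hyps by blast
  then obtain z where "z \<notin> (\<Union>q\<in>insert p A. bad q)"
    using ex_new_if_finite[OF infinite_UNIV_char_0] by blast
  then show ?case using W[OF g(1) h(1), of z] unfolding bad_def by blast
qed

lemma jac_const_imp_nonconst:
  assumes "jac P Q = const2 c" "c \<noteq> 0"
  shows "P \<noteq> const2 z" "Q \<noteq> const2 z"
  using assms by (auto simp: jac_def)

lemma degree_diff_const:
  fixes p :: "'a :: comm_ring_1 poly"
  assumes "degree p > 0"
  shows "degree (p - [:c:]) = degree p"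
  unfolding diff_conv_add_uminus using assms by (intro degree_add_eq_left) simp

section \<open>Equations for the missed points\<close>

text \<open>
  Constant leading coefficients in \<open>Y\<close> ensure that the resultant with respect to \<open>Y\<close> commutes with
  specialisation of \<open>X\<close>, so that its roots are exactly the \<open>X\<close>-coordinates of the common zeros.
\<close>

locale monic_keller_pair =
  fixes P Q :: bipoly and \<alpha> \<beta> c :: complex
  assumes jac: "jac P Q = const2 c" "c \<noteq> 0"
    and lead_P: "lead_coeff P = [:\<alpha>:]" "\<alpha> \<noteq> 0"
    and lead_Q: "lead_coeff Q = [:\<beta>:]" "\<beta> \<noteq> 0"
begin

lemma deg_pos: "degree P > 0" "degree Q > 0"
proof -
  have "R = const2 z" if "degree R = 0" "lead_coeff R = [:z:]" for R z
    using that degree_eq_zeroE[of R] by force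
  then show "degree P > 0" "degree Q > 0"
    using jac_const_imp_nonconst[OF jac] lead_P lead_Q by blast+
qed

text \<open>
  Two specialisations of one polynomial in \<open>u\<close>, \<open>v\<close>, \<open>X\<close>, the resultant of \<open>P - u\<close> and \<open>Q - v\<close> with
  respect to \<open>Y\<close>:  \<open>res_X a b\<close> fixes \<open>(u, v) = (a, b)\<close> and is a polynomial in \<open>X\<close>, while \<open>res_uv x\<close>
  fixes \<open>X = x\<close> and is a polynomial in \<open>u\<close> (inner variable) and \<open>v\<close> (outer variable).
\<close>

definition res_X :: "complex \<Rightarrow> complex \<Rightarrow> complex poly" where
  "res_X a b = resultant (P - const2 a) (Q - const2 b)"

definition res_uv :: "complex \<Rightarrow> bipoly" where
  "res_uv x = resultant (map_poly const2 (slice P x) - [:[:[:0, 1:]:]:])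
                        (map_poly const2 (slice Q x) - [:[:0, 1:]:])"

lemma degree_slice: "degree (slice P x) = degree P" "degree (slice Q x) = degree Q"
  unfolding slice_def using lead_P lead_Q
  by (auto intro!: degree_map_poly)

lemma poly_res_X:
  "poly (res_X a b) x = resultant (slice P x - [:a:]) (slice Q x - [:b:])"
proof -
  have sl: "map_poly (\<lambda>r. poly r x) (R - const2 z) = slice R x - [:z:]" for R z
    by (rule poly_eqI) (simp add: slice_def coeff_map_poly coeff_pCons split: nat.split)
  have "resultant (map_poly (\<lambda>r. poly r x) (P - const2 a)) (map_poly (\<lambda>r. poly r x) (Q - const2 b))
      = poly (resultant (P - const2 a) (Q - const2 b)) x"
    by (rule comm_ring_hom.resultant_map_poly[OF poly_hom.comm_ring_hom_axioms])
       (simp_all only: sl degree_diff_const degree_slice deg_pos)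
  then show ?thesis by (simp only: sl res_X_def)
qed

lemma eval2_res_uv:
  "eval2 (res_uv x) a b = resultant (slice P x - [:a:]) (slice Q x - [:b:])"
proof -
  have sl: "map_poly (\<lambda>h. eval2 h a b) (map_poly const2 r - [:w:]) = r - [:eval2 w a b:]" for r w
    by (rule poly_eqI) (simp add: coeff_map_poly coeff_pCons split: nat.split)
  have dl: "degree (map_poly const2 r) = degree r" for r
    by (rule degree_map_poly) simp
  show ?thesis
    unfolding res_uv_def
    by (subst comm_ring_hom.resultant_map_poly[OF eval2_hom, symmetric])
       (use deg_pos in \<open>simp_all add: sl degree_diff_const degree_slice dl\<close>)
qed

lemma res_X_nonzero: "res_X a b \<noteq> 0"
proof
  assume "res_X a b = 0"
  then obtain p where "degree p > 0" "p dvd P - const2 a" "p dvd Q - const2 b"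
    using resultant_eq_0_imp_common_prime unfolding res_X_def by blast
  then show False using jac_imp_no_common_factor[OF jac] by fastforce
qed

lemma res_X_root_iff: "poly (res_X a b) x = 0 \<longleftrightarrow> (\<exists>y. eval2 P x y = a \<and> eval2 Q x y = b)"
proof
  assume "poly (res_X a b) x = 0"
  then obtain y where "poly (slice P x - [:a:]) y = 0" "poly (slice Q x - [:b:]) y = 0"
    using complex_resultant_eq_0_imp_common_root unfolding poly_res_X by blast
  then show "\<exists>y. eval2 P x y = a \<and> eval2 Q x y = b" by (auto simp: poly_slice)
next
  assume "\<exists>y. eval2 P x y = a \<and> eval2 Q x y = b"
  then obtain y where "eval2 P x y = a" "eval2 Q x y = b" by blast
  then show "poly (res_X a b) x = 0"
    unfolding res_X_def using deg_pos
    by (intro resultant_common_root[where y = y]) (simp_all add: degree_diff_const)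
qed

lemma missed_iff_res_X_const: "(a, b) \<in> missed P Q \<longleftrightarrow> degree (res_X a b) = 0"
proof
  assume "(a, b) \<in> missed P Q"
  then have "poly (res_X a b) x \<noteq> 0" for x
    using res_X_root_iff by (auto simp: missed_def)
  then show "degree (res_X a b) = 0"
    using alg_closed_imp_poly_has_root by blast
next
  assume "degree (res_X a b) = 0"
  then obtain z where "res_X a b = [:z:]" by (rule degree_eq_zeroE)
  then show "(a, b) \<in> missed P Q"
    using res_X_nonzero[of a b] res_X_root_iff[of a b] by (auto simp: missed_def)
qed

text \<open>
  All equations of bounded bidegree that hold on the missed points, rather than only those coming
  from resultants: this is a vector space, so that generic members can be chosen in it.
\<close>

definition missed_eqns :: "bipoly set" where
  "missed_eqns = {g. degree g \<le> degree P \<and> (\<forall>j. degree (coeff g j) \<le> degree Q) \<and>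
              (\<forall>(a, b)\<in>missed P Q. eval2 g a b = 0)}"

lemma missed_eqns_closed: "0 \<in> missed_eqns" "g \<in> missed_eqns \<Longrightarrow> h \<in> missed_eqns \<Longrightarrow> g + const2 z * h \<in> missed_eqns"
  by (fastforce simp: missed_eqns_def intro!: degree_add_le order_trans[OF degree_smult_le])+

lemma degree_res_uv: 
  "degree (res_uv x) \<le> degree P" "degree (coeff (res_uv x) j) \<le> degree Q"
proof -
  have dl: "degree (map_poly const2 r) = degree r" for r
    by (rule degree_map_poly) simp
  have deg: "degree (map_poly const2 (slice P x) - [:[:[:0, 1:]:]:]) = degree P"
    "degree (map_poly const2 (slice Q x) - [:[:0, 1:]:]) = degree Q"
    using deg_pos by (simp_all add: degree_diff_const degree_slice dl)
  have "degree (res_uv x) \<le> degree Q * 0 + degree P * 1"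
    unfolding res_uv_def deg[symmetric]
    by (rule degree_filtration.resultant[OF degree_filtration_degree])
       (auto simp: coeff_map_poly coeff_pCons split: nat.split)
  then show "degree (res_uv x) \<le> degree P" by simp
  have "\<forall>j. degree (coeff (res_uv x) j) \<le> degree Q * 1 + degree P * 0"
    unfolding res_uv_def deg[symmetric]
    by (rule degree_filtration.resultant[OF degree_filtration_coeff_degree])
       (auto simp: coeff_map_poly coeff_pCons split: nat.split)
  then show "degree (coeff (res_uv x) j) \<le> degree Q" by simp
qed

text \<open>
  At a missed point the resultant does not depend on \<open>X\<close>, so its values at two places agree.
\<close>

lemma res_uv_diff_in_missed_eqns: "res_uv x - res_uv x' \<in> missed_eqns"
proof -
  have "eval2 (res_uv x - res_uv x') a b = 0" if "(a, b) \<in> missed P Q" for a b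
  proof -
    have "degree (res_X a b) = 0" using that by (simp add: missed_iff_res_X_const)
    then obtain z where "res_X a b = [:z:]" by (rule degree_eq_zeroE)
    then have "eval2 (res_uv x) a b = z" for x
      by (metis eval2_res_uv poly_res_X poly_const_conv)
    then show ?thesis by simp
  qed
  then show ?thesis
    unfolding missed_eqns_def by (auto intro!: degree_diff_le degree_res_uv)
qed

text \<open>
  Suppose that \<open>p\<close> divides all the equations.  At a zero \<open>(a, b)\<close> of \<open>p\<close> the polynomial \<open>res_X a b\<close>
  is then constant, so the fibre over \<open>(a, b)\<close> is empty.  Hence \<open>p(P, Q)\<close> vanishes nowhere, which makes
  it a constant, against the algebraic independence of \<open>P\<close> and \<open>Q\<close>.
\<close>

lemma missed_eqns_no_common_divisor:
  assumes "degree p > 0"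
  shows "\<exists>g\<in>missed_eqns. \<not> p dvd g"
proof (rule ccontr)
  assume "\<not> (\<exists>g\<in>missed_eqns. \<not> p dvd g)"
  then have dvd: "p dvd res_uv x - res_uv x'" for x x'
    using res_uv_diff_in_missed_eqns by blast
  have "eval2 p (eval2 P x y) (eval2 Q x y) \<noteq> 0" for x y
  proof
    define a b where "a = eval2 P x y" and "b = eval2 Q x y"
    assume "eval2 p (eval2 P x y) (eval2 Q x y) = 0"
    then have p0: "eval2 p a b = 0" by (simp add: a_def b_def)
    have "eval2 (res_uv x' - res_uv x) a b = 0" for x'
    proof -
      obtain k where "res_uv x' - res_uv x = p * k" using dvd[of x' x] by (rule dvdE)
      then show ?thesis using p0 by (simp only: eval2_simps(5) mult_zero_left)
    qed
    then have "eval2 (res_uv x') a b = eval2 (res_uv x) a b" for x' by simp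
    then have "poly (res_X a b) x' = poly (res_X a b) x" for x'
      by (metis eval2_res_uv poly_res_X)
    moreover have "poly (res_X a b) x = 0"
      using res_X_root_iff a_def b_def by blast
    ultimately show False
      using res_X_nonzero[of a b] poly_all_0_iff_0 by metis
  qed
  then have "eval2 (comp2 p P Q) x y \<noteq> 0" for x y by (simp add: eval2_comp2)
  then obtain z where "comp2 p P Q = const2 z" using bipoly_no_zero_imp_const by blast
  then have "comp2 (p - const2 z) P Q = 0" by (simp add: comp2_diff)
  then have "p - const2 z = 0" by (rule jac_imp_alg_independent[OF jac])
  then show False using assms by simp
qed

text \<open>
  Elimination of \<open>v\<close>: the first coordinates of the missed points are roots of the resultant with
  respect to \<open>v\<close> of two equations without a common factor of positive degree in \<open>v\<close>.  For a given
  first equation \<open>f\<close>, a generic \<open>g\<close> is divisible by no prime factor of \<open>f\<close> of this kind.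
\<close>

lemma card_missed_inj_fst:
  assumes S: "S \<subseteq> missed P Q" and inj: "inj_on fst S"
  shows "card S \<le> 2 * degree P * degree Q"
proof -
  have main: "card S \<le> degree r" if r: "r \<noteq> 0" "\<And>a b. (a, b) \<in> S \<Longrightarrow> poly r a = 0" for r
  proof -
    have "card S = card (fst ` S)" using inj by (simp add: card_image)
    also have "\<dots> \<le> card {a. poly r a = 0}"
      using r by (intro card_mono poly_roots_finite) auto
    also have "\<dots> \<le> degree r" using r by (intro card_poly_roots_bound)
    finally show ?thesis .
  qed
  \<comment> \<open>Some equation is not divisible by the polynomial \<open>v\<close>, hence is nonzero.\<close>
  obtain f where f: "f \<in> missed_eqns" "f \<noteq> 0"
    using missed_eqns_no_common_divisor[of "[:0, 1:]"] by auto
  have zero: "eval2 g a b = 0" if "g \<in> missed_eqns" "(a, b) \<in> S" for g a b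
    using that S by (auto simp: missed_eqns_def)
  show ?thesis
  proof (cases "degree f = 0")
    \<comment> \<open>Here \<open>f\<close> is a polynomial in \<open>u\<close> alone; the resultant of \<open>f\<close> with another such polynomial would be 1.\<close>
    case True
    then obtain r where r: "f = [:r:]" by (rule degree_eq_zeroE)
    have "card S \<le> degree r" using main f zero[OF f(1)] by (auto simp: r)
    also have "\<dots> \<le> degree Q" using f(1) by (auto simp: missed_eqns_def r dest: spec[of _ 0])
    also have "\<dots> \<le> 2 * degree P * degree Q" using deg_pos by simp
    finally show ?thesis .
  next
    case False
    define A where "A = {p. prime p \<and> p dvd f \<and> degree p > 0}"
    have "A \<subseteq> prime_factors f" using f by (auto simp: A_def in_prime_factors_iff)
    then have "finite A" by (rule finite_subset) simp
    then obtain g where g: "g \<in> missed_eqns" "\<And>p. p \<in> A \<Longrightarrow> \<not> p dvd g"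
      using linear_family_avoids_divisors[of A missed_eqns] missed_eqns_closed missed_eqns_no_common_divisor
      unfolding A_def by blast
    have res: "resultant f g \<noteq> 0"
      using resultant_eq_0_imp_common_prime[of f g] g(2) unfolding A_def by blast
    have "card S \<le> degree (resultant f g)"
    proof (rule main[OF res])
      fix a b assume "(a, b) \<in> S"
      then show "poly (resultant f g) a = 0"
        using False zero f g by (intro resultant_common_root) auto
    qed
    also have "\<dots> \<le> degree g * degree Q + degree f * degree Q"
      using f(1) g(1) 
      by (intro degree_filtration.resultant[OF degree_filtration_degree]) (auto simp: missed_eqns_def)
    also have "\<dots> \<le> degree P * degree Q + degree P * degree Q"
      using f(1) g(1) by (intro add_mono mult_right_mono) (auto simp: missed_eqns_def)
    finally show ?thesis by simp
  qed
qed

end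

section \<open>Linear changes of the source\<close>

lemma total_degree_le_iff:
  "total_degree p \<le> k \<longleftrightarrow> (\<forall>i j. coeff (coeff p j) i \<noteq> 0 \<longrightarrow> i + j \<le> k)"
  unfolding total_degree_def using finite_monomials[of p]
  by (auto simp: monomials_def)

lemma total_degree_attained:
  assumes "total_degree p > 0"
  shows "\<exists>i j. coeff (coeff p j) i \<noteq> 0 \<and> i + j = total_degree p"
proof -
  have "total_degree p \<in> insert 0 ((\<lambda>(i, j). i + j) ` monomials p)"
    unfolding total_degree_def using finite_monomials[of p] by (intro Max_in) auto
  then obtain i j where "(i, j) \<in> monomials p" "i + j = total_degree p"
    using assms by auto
  then show ?thesis unfolding monomials_def by blast
qed

lemma total_degree_0_imp_const:
  assumes "total_degree p = 0"
  shows "\<exists>z. p = const2 z"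
proof -
  have 0: "coeff (coeff p j) i = 0" if "i + j > 0" for i j
    using assms total_degree_le_iff[of p 0] that by auto
  have "p = const2 (coeff (coeff p 0) 0)"
    by (rule poly_eqI, rule poly_eqI) (auto simp: 0 coeff_pCons split: nat.split)
  then show ?thesis by blast
qed

text \<open>The substitution \<open>X := X + t * Y\<close>.\<close>

definition shear :: "complex \<Rightarrow> bipoly \<Rightarrow> bipoly" where
  "shear t p = comp2 p [:[:0, 1:], [:t:]:] [:0, 1:]"

lemma partial_1: "partial_X 1 = 0" "partial_Y 1 = 0"
  using partial_X_pCons[of 1 0] partial_Y_pCons[of 1 0] by simp_all

lemma shear_const2: "shear t (const2 c) = const2 c"
  by (simp add: shear_def)

lemma jac_shear: "jac (shear t P) (shear t Q) = shear t (jac P Q)"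
proof -
  let ?A = "[:[:0, 1:], [:t:]:] :: bipoly" and ?B = "[:0, 1:] :: bipoly"
  have "partial_X ?A = 1" "partial_Y ?A = const2 t" "partial_X ?B = 0" "partial_Y ?B = 1"
    by (simp_all add: pderiv_pCons partial_1)
  then show ?thesis
    unfolding jac_def shear_def partial_comp2 comp2_diff comp2_mult
    by (simp add: algebra_simps)
qed

lemma missed_shear: "missed P Q \<subseteq> missed (shear t P) (shear t Q)"
  by (auto simp: missed_def shear_def eval2_comp2)

text \<open>The homogeneous component of top degree of \<open>p\<close>, evaluated at \<open>(t, 1)\<close>, as a polynomial in \<open>t\<close>.\<close>

definition top_coeff_poly :: "bipoly \<Rightarrow> complex poly" where
  "top_coeff_poly p = (\<Sum>j\<le>total_degree p. monom (coeff (coeff p j) (total_degree p - j)) (total_degree p - j))"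

lemma top_coeff_poly_nonzero:
  assumes "total_degree p > 0"
  shows "top_coeff_poly p \<noteq> 0"
proof -
  let ?d = "total_degree p"
  obtain i j where ij: "coeff (coeff p j) i \<noteq> 0" "i + j = ?d"
    using total_degree_attained[OF assms] by blast
  have "coeff (top_coeff_poly p) i
      = (\<Sum>j'\<le>?d. if j' = j then coeff (coeff p j) i else 0)"
    unfolding top_coeff_poly_def coeff_sum coeff_monom using ij(2) by (intro sum.cong) auto
  also have "\<dots> = coeff (coeff p j) i" using ij(2) by simp
  finally show ?thesis using ij(1) by auto
qed

lemma comp1_expand: "comp1 c A = (\<Sum>i\<le>degree c. const2 (coeff c i) * A ^ i)"
  unfolding comp1_def poly_altdef by (cases "c = 0") (simp_all add: degree_map_poly coeff_map_poly)

lemma comp2_expand: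
  "comp2 p A B = (\<Sum>j\<le>degree p. \<Sum>i\<le>degree (coeff p j). const2 (coeff (coeff p j) i) * (A ^ i * B ^ j))"
proof -
  have "comp2 p A B = (\<Sum>j\<le>degree p. comp1 (coeff p j) A * B ^ j)"
    unfolding comp2_def poly_altdef[of "map_poly _ p"]
  proof (intro sum.mono_neutral_cong_left ballI)
    let ?q = "map_poly (\<lambda>c. comp1 c A) p"
    show "{..degree ?q} \<subseteq> {..degree p}" by (simp add: degree_map_poly_le)
    fix j assume "j \<in> {..degree p} - {..degree ?q}"
    then have "coeff ?q j = 0" by (intro coeff_eq_0) simp
    then show "comp1 (coeff p j) A * B ^ j = 0" by (simp add: coeff_map_poly)
  qed (simp_all add: coeff_map_poly)
  then show ?thesis by (simp add: comp1_expand sum_distrib_right mult.assoc)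
qed

lemma linear_power:
  fixes r t :: "'a :: idom"
  shows "degree ([:r, t:] ^ i) \<le> i" "coeff ([:r, t:] ^ i) i = t ^ i"
proof -
  show deg: "degree ([:r, t:] ^ i) \<le> i"
    using degree_power_le[of "[:r, t:]" i] by (auto split: if_splits)
  show "coeff ([:r, t:] ^ i) i = t ^ i"
  proof (cases "t = 0")
    case True
    then have "[:r, t:] ^ i = [:r ^ i:]" by (simp add: poly_const_pow)
    with True show ?thesis by (cases i) (simp_all)
  next
    case False
    then show ?thesis 
      using lead_coeff_power[of "[:r, t:]" i] by (simp add: degree_power_eq)
  qed
qed

text \<open>
  A monomial \<open>X ^ i * Y ^ j\<close> becomes a polynomial of degree at most \<open>i + j\<close> in \<open>Y\<close> with coefficient
  \<open>t ^ i\<close> at \<open>Y ^ (i + j)\<close>, so only monomials of top total degree contribute at the top.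
\<close>

lemma shear_leading:
  shows "degree (shear t p) \<le> total_degree p"
    and "coeff (shear t p) (total_degree p) = [:poly (top_coeff_poly p) t:]"
proof -
  let ?d = "total_degree p"
  let ?A = "[:[:0, 1:], [:t:]:] :: bipoly" and ?B = "[:0, 1:] :: bipoly"
  have le: "i + j \<le> ?d" if "coeff (coeff p j) i \<noteq> 0" for i j
    using that total_degree_le_iff[of p ?d] by blast
  have B: "?B ^ j = monom 1 j" for j by (simp add: monom_altdef)
  have deg: "degree (?A ^ i * ?B ^ j) \<le> i + j" for i j
    using degree_mult_le[of "?A ^ i" "?B ^ j"] linear_power(1)[of "[:0,1:]" "[:t:]" i]
      linear_power(1)[of 0 "1 :: complex poly" j] by linarith
  have "degree (const2 (coeff (coeff p j) i) * (?A ^ i * ?B ^ j)) \<le> ?d" for i j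
  proof (cases "coeff (coeff p j) i = 0")
    case False
    then show ?thesis
      using degree_mult_le[of "const2 (coeff (coeff p j) i)" "?A ^ i * ?B ^ j"] deg[of i j] le[of j i]
      by simp
  qed simp
  then show "degree (shear t p) \<le> ?d"
    unfolding shear_def comp2_expand by (intro degree_sum_le) auto
  have co: "coeff (const2 (coeff (coeff p j) i) * (?A ^ i * ?B ^ j)) ?d
      = (if i + j = ?d then [:coeff (coeff p j) i * t ^ i:] else 0)" for i j
  proof (cases "coeff (coeff p j) i = 0")
    case False
    have "coeff (?A ^ i * ?B ^ j) (i + j) = [:t ^ i:]"
      unfolding B by (simp add: coeff_monom_mult mult.commute linear_power poly_const_pow)
    then show ?thesis
      using deg[of i j] le[OF False] by (auto simp: coeff_eq_0)
  qed simp
  have "coeff (shear t p) ?d = (\<Sum>j\<le>degree p. \<Sum>i\<le>degree (coeff p j).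
      if i + j = ?d then [:coeff (coeff p j) i * t ^ i:] else 0)"
    unfolding shear_def comp2_expand coeff_sum co ..
  also have "\<dots> = (\<Sum>j\<le>?d. [:coeff (coeff p j) (?d - j) * t ^ (?d - j):])"
  proof (rule sum.mono_neutral_cong)
    fix j assume "j \<in> {..degree p} \<inter> {..?d}"
    then have "(\<Sum>i\<le>degree (coeff p j). if i + j = ?d then [:coeff (coeff p j) i * t ^ i:] else 0)
       = (\<Sum>i\<le>degree (coeff p j). if i = ?d - j then [:coeff (coeff p j) i * t ^ i:] else 0)"
      by (intro sum.cong) auto
    also have "\<dots> = [:coeff (coeff p j) (?d - j) * t ^ (?d - j):]"
      by (auto simp: coeff_eq_0)
    finally show "(\<Sum>i\<le>degree (coeff p j). if i + j = ?d then [:coeff (coeff p j) i * t ^ i:] else 0)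
       = [:coeff (coeff p j) (?d - j) * t ^ (?d - j):]" .
  qed (auto simp: coeff_eq_0 intro!: sum.neutral)
  also have "\<dots> = [:poly (top_coeff_poly p) t:]"
  proof -
    have "(\<Sum>j\<in>J. [:u j:]) = [:\<Sum>j\<in>J. u j:]" for J :: "nat set" and u :: "nat \<Rightarrow> complex"
      by (induction J rule: infinite_finite_induct) simp_all
    then show ?thesis by (simp add: top_coeff_poly_def poly_sum poly_monom)
  qed
  finally show "coeff (shear t p) ?d = [:poly (top_coeff_poly p) t:]" .
qed

section \<open>The number of missed points\<close>

lemma keller_total_degree_pos:
  assumes "jac P Q = const2 c" "c \<noteq> 0"
  shows "total_degree P > 0" "total_degree Q > 0"
  using total_degree_0_imp_const jac_const_imp_nonconst[OF assms] by blast+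

text \<open>
  For all but finitely many \<open>t\<close> the shear makes both leading coefficients in \<open>Y\<close> nonzero constants; it
  preserves the constant Jacobian determinant and the image.
\<close>

lemma keller_card_missed_inj_fst:
  assumes jac: "jac P Q = const2 c" "c \<noteq> 0"
    and S: "S \<subseteq> missed P Q" "inj_on fst S"
  shows "card S \<le> 2 * total_degree P * total_degree Q"
proof -
  note pos = keller_total_degree_pos[OF jac]
  let ?r = "top_coeff_poly P * top_coeff_poly Q"
  have "finite {t. poly ?r t = 0}"
    using pos by (intro poly_roots_finite) (simp add: top_coeff_poly_nonzero)
  then obtain t where t: "poly ?r t \<noteq> 0"
    using ex_new_if_finite[OF infinite_UNIV_char_0] by blast
  have lead: "degree (shear t p) = total_degree p \<and> lead_coeff (shear t p) = [:poly (top_coeff_poly p) t:]"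
    if "poly (top_coeff_poly p) t \<noteq> 0" for p
  proof -
    have "degree (shear t p) = total_degree p"
      using shear_leading[where t = t and p = p] that by (intro antisym le_degree) auto
    then show ?thesis using shear_leading(2)[of t p] by simp
  qed
  have lP: "degree (shear t P) = total_degree P" "lead_coeff (shear t P) = [:poly (top_coeff_poly P) t:]"
    and lQ: "degree (shear t Q) = total_degree Q" "lead_coeff (shear t Q) = [:poly (top_coeff_poly Q) t:]"
    using lead[of P] lead[of Q] t by auto
  have "monic_keller_pair (shear t P) (shear t Q)
      (poly (top_coeff_poly P) t) (poly (top_coeff_poly Q) t) c"
    by unfold_locales (use jac t lP lQ in \<open>auto simp: jac_shear shear_const2\<close>)
  moreover have "S \<subseteq> missed (shear t P) (shear t Q)" using S(1) missed_shear by blast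
  ultimately show ?thesis
    using monic_keller_pair.card_missed_inj_fst S(2) unfolding lP(1)[symmetric] lQ(1)[symmetric] by blast
qed

lemma exists_injective_projection:
  fixes S :: "(complex \<times> complex) set"
  assumes "finite S"
  shows "\<exists>t. inj_on (\<lambda>(a, b). a + t * b) S"
proof -
  let ?bad = "(\<lambda>((a, b), (a', b')). (a' - a) / (b - b')) ` (S \<times> S)"
  have "finite ?bad" using assms by simp
  then obtain t where t: "t \<notin> ?bad"
    using ex_new_if_finite[OF infinite_UNIV_char_0] by blast
  have "inj_on (\<lambda>(a, b). a + t * b) S"
  proof (rule inj_onI, clarsimp)
    fix a b a' b' assume ab: "(a, b) \<in> S" "(a', b') \<in> S" and eq: "a + t * b = a' + t * b'"
    have "b = b'"
    proof (rule ccontr)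
      assume "b \<noteq> b'"
      then have "t = (a' - a) / (b - b')" using eq by (simp add: field_simps)
      then show False using t ab by force
    qed
    then show "a = a' \<and> b = b'" using eq by simp
  qed
  then show ?thesis ..
qed

text \<open>
  A generic \<open>P + t * Q\<close> in place of \<open>P\<close> separates the points of \<open>S\<close> by their first coordinates.
\<close>

lemma keller_card_missed_finite_subset:
  assumes jac: "jac P Q = const2 c" "c \<noteq> 0"
    and S: "S \<subseteq> missed P Q" "finite S"
  shows "card S \<le> 2 * max (total_degree P) (total_degree Q) ^ 2"
proof -
  let ?d = "max (total_degree P) (total_degree Q)"
  obtain t where t: "inj_on (\<lambda>(a, b). a + t * b) S"
    using exists_injective_projection[OF S(2)] by blast
  define P' where "P' = P + smult [:t:] Q"
  define T where "T = (\<lambda>(a, b). (a + t * b, b)) ` S"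
  have "partial_Y (smult [:t:] Q) = smult [:t:] (partial_Y Q)"
    by (simp add: partial_Y_def pderiv_smult)
  then have "jac P' Q = const2 c"
    using jac unfolding P'_def jac_def by (simp add: partial_X_smult algebra_simps)
  moreover have "T \<subseteq> missed P' Q"
    using S(1) by (force simp: T_def P'_def missed_def)
  moreover have "inj_on fst T"
    using t by (force simp: T_def inj_on_def)
  ultimately have "card T \<le> 2 * total_degree P' * total_degree Q"
    using keller_card_missed_inj_fst jac(2) by blast
  moreover have "card T = card S"
    unfolding T_def by (rule card_image) (auto simp: inj_on_def)
  moreover have "total_degree P' \<le> ?d"
    unfolding total_degree_le_iff
  proof (intro allI impI)
    fix i j assume "coeff (coeff P' j) i \<noteq> 0"
    then have "coeff (coeff P j) i \<noteq> 0 \<or> coeff (coeff Q j) i \<noteq> 0"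
      by (auto simp: P'_def)
    then show "i + j \<le> ?d"
      using total_degree_le_iff[of P ?d] total_degree_le_iff[of Q ?d] by auto
  qed
  then have "total_degree P' * total_degree Q \<le> ?d * ?d"
    by (rule mult_le_mono) simp
  ultimately show ?thesis by (simp add: power2_eq_square)
qed

text \<open>
  In degree 1 the bound \<open>2 * d ^ 2\<close> exceeds \<open>d ^ 3 + d ^ 2 - d\<close>, so this case is settled by solving the
  linear equations with Cramer's rule.
\<close>

lemma keller_degree_1_surj:
  assumes jac: "jac P Q = const2 c" "c \<noteq> 0"
    and deg: "total_degree P \<le> 1" "total_degree Q \<le> 1"
  shows "missed P Q = {}"
proof -
  have lin: "\<exists>r0 r1 r2. R = [:[:r0, r1:], [:r2:]:]" if "total_degree R \<le> 1" for R
  proof -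
    have 0: "coeff (coeff R j) i = 0" if "i + j > 1" for i j
      using \<open>total_degree R \<le> 1\<close> that by (force simp: total_degree_le_iff)
    have "R = [:[:coeff (coeff R 0) 0, coeff (coeff R 0) 1:], [:coeff (coeff R 1) 0:]:]"
      by (rule poly_eqI, rule poly_eqI) (auto simp: 0 coeff_pCons split: nat.split)
    then show ?thesis by blast
  qed
  obtain p0 p1 p2 where P: "P = [:[:p0, p1:], [:p2:]:]" using lin deg(1) by blast
  obtain q0 q1 q2 where Q: "Q = [:[:q0, q1:], [:q2:]:]" using lin deg(2) by blast
  have c: "p1 * q2 - p2 * q1 = c"
    using jac(1) by (simp add: P Q jac_def pderiv_pCons)
  have "\<exists>x y. eval2 P x y = a \<and> eval2 Q x y = b" for a b
  proof (intro exI conjI)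
    let ?x = "((a - p0) * q2 - (b - q0) * p2) / c" and ?y = "((b - q0) * p1 - (a - p0) * q1) / c"
    have "p1 * ((a - p0) * q2 - (b - q0) * p2) + p2 * ((b - q0) * p1 - (a - p0) * q1) = (a - p0) * c"
      "q1 * ((a - p0) * q2 - (b - q0) * p2) + q2 * ((b - q0) * p1 - (a - p0) * q1) = (b - q0) * c"
      unfolding c[symmetric] by (simp_all add: algebra_simps)
    moreover have "r * (u / c) + s * (v / c) = (r * u + s * v) / c" for r s u v
      by (simp add: add_divide_distrib)
    ultimately have "p1 * ?x + p2 * ?y = a - p0" "q1 * ?x + q2 * ?y = b - q0"
      using jac(2) by simp_all
    then show "eval2 P ?x ?y = a" "eval2 Q ?x ?y = b"
      by (simp_all add: P Q algebra_simps)
  qed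
  then show ?thesis by (auto simp: missed_def)
qed

theorem theorem5p6:
  fixes F :: "bipoly \<times> bipoly"
  assumes "\<exists>c::complex. c \<noteq> 0 \<and> det (jacobian2 F) = [:[:c:]:]"
  shows "finite (UNIV - range (poly_mapping2 F)) \<and>
    int (card (UNIV - range (poly_mapping2 F)))
      \<le> int (degree2 F) ^ 3 + int (degree2 F) ^ 2 - int (degree2 F)"
proof -
  obtain P Q where F: "F = (P, Q)" by (cases F)
  obtain c where c: "jac P Q = const2 c" "c \<noteq> 0"
    using assms by (auto simp: F det_jacobian2 jac_def)
  define d where "d = degree2 F"
  have d: "d = max (total_degree P) (total_degree Q)" by (simp add: d_def degree2_def F)
  have M: "UNIV - range (poly_mapping2 F) = missed P Q"
    by (auto simp: missed_def poly_mapping2_def F image_iff)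
  have fin: "finite (missed P Q) \<and> card (missed P Q) \<le> 2 * d ^ 2"
    using keller_card_missed_finite_subset[OF c]
    by (intro finite_if_finite_subsets_card_bdd) (auto simp: d)
  have "d \<ge> 1" using keller_total_degree_pos[OF c] by (simp add: d)
  have "int (card (missed P Q)) \<le> int d ^ 3 + int d ^ 2 - int d"
  proof (cases "d = 1")
    case True
    then show ?thesis using keller_degree_1_surj[OF c] by (simp add: d)
  next
    case False
    \<comment> \<open>The product below is \<open>d * (d ^ 2 - d - 1)\<close>.\<close>
    have "0 \<le> int d * ((int d - 2) * (int d + 1) + 1)"
      using False \<open>d \<ge> 1\<close> by (intro mult_nonneg_nonneg add_nonneg_nonneg) auto
    also have "\<dots> = int d ^ 3 + int d ^ 2 - int d - 2 * int d ^ 2"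
      by (simp add: algebra_simps power2_eq_square power3_eq_cube)
    finally have "2 * int d ^ 2 \<le> int d ^ 3 + int d ^ 2 - int d" by simp
    moreover have "int (card (missed P Q)) \<le> 2 * int d ^ 2"
      using fin by (metis of_nat_le_iff of_nat_mult of_nat_numeral of_nat_power)
    ultimately show ?thesis by linarith
  qed
  with fin show ?thesis unfolding M d_def by blast
qed

end
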